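(* Let $n\in\mathbb{N}$, $p\in[0,1]$, $q=1-p$, and let $\alpha=(\alpha_1,\dots,\alpha_n)\in[n]^n$ satisfy $\alpha_i\le i$ for all $i\in[n]$. Put $d_i=i-\alpha_i$. Under the unbounded model of the probabilistic parking protocol with preference list $\alpha$ and parameter $p$, $$\Pr[X_\alpha=1]=\begin{cases}1 & \text{if }\tfrac12\le p\le1,\\ \left(\frac pq\right)^{\sum_{i=1}^n d_i} & \text{if }0\le p<\tfrac12.\end{cases}$$ Furthermore, for $1/2<p\le1$, $$\mathbb{E}[\tau_\alpha\mid X_\alpha=1]=\frac1{p-q}\sum_{i=1}^n d_i\qquad\text{and}\qquad \operatorname{Var}[\tau_\alpha\mid X_\alpha=1]=\frac{4pq}{(p-q)^3}\sum_{i=1}^n d_i .$$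
   Context: $[n]=\{1,\dots,n\}$; the convention $0^0=1$ is used. Preference lists with $\alpha_i\le i$ for all $i$ are exactly the parking functions whose classical outcome is the identity permutation. Probabilistic parking protocol, unbounded model: cars $1,2,\dots,n$ arrive one at a time in this order, and a car enters only after its predecessor has completed its search. Car $i$ starts at spot $\alpha_i$ and performs a nearest-neighbour random walk on $\mathbb{Z}$ (independent of the walks of the other cars), each step being $+1$ with probability $p$ and $-1$ with probability $q=1-p$, until it first visits an unoccupied spot in $[n]$, where it parks immediately (in zero steps if $\alpha_i$ is itself unoccupied). Cars may move anywhere in $\mathbb{Z}$ but can only park in $[n]$. If a car never reaches an unoccupied spot of $[n]$, it does not park (and no later car enters or parks). $X_\alpha$ is the indicator that all $n$ cars park. $\tau_\alpha^i$ is the number of steps car $i$ takes until it first hits position $i$ (when cars $1,\dots,i-1$ have parked, they occupy spots $1,\dots,i-1$, and car $i$ parks iff it hits $i$), and $\tau_\alpha=\sum_{i=1}^n\tau_\alpha^i$ is the total time the protocol takes to complete. *)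

theory Defs
  imports "HOL-Probability.Probability"
begin

text \<open>Car \<open>i\<close> draws the increments of its walk from its own sequence \<open>\<xi> i 0, \<xi> i 1, \<dots>\<close>.
  The sequence is infinite, but the protocol only looks at it up to the time the car parks.\<close>

locale parking_steps = prob_space M for M :: "'a measure" +
  fixes n :: nat and p :: real and \<xi> :: "nat \<Rightarrow> nat \<Rightarrow> 'a \<Rightarrow> int"
  assumes indep_steps:
      "indep_vars (\<lambda>_. count_space UNIV) (\<lambda>(i, k). \<xi> i k) ({1..n} \<times> UNIV)"
    and prob_step_up: "\<And>i k. i \<in> {1..n} \<Longrightarrow> prob {\<omega> \<in> space M. \<xi> i k \<omega> = 1} = p"
    and prob_step_down: "\<And>i k. i \<in> {1..n} \<Longrightarrow> prob {\<omega> \<in> space M. \<xi> i k \<omega> = -1} = 1 - p"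

definition walk :: "(nat \<Rightarrow> nat) \<Rightarrow> (nat \<Rightarrow> nat \<Rightarrow> 'a \<Rightarrow> int) \<Rightarrow> 'a \<Rightarrow> nat \<Rightarrow> nat \<Rightarrow> int" where
  "walk \<alpha> \<xi> \<omega> i t = int (\<alpha> i) + (\<Sum>k<t. \<xi> i k \<omega>)"

text \<open>The infimum of the empty set is \<open>\<infinity>\<close>.\<close>

definition hitting_time :: "(nat \<Rightarrow> int) \<Rightarrow> int set \<Rightarrow> enat" where
  "hitting_time w A = Inf (enat ` {t. w t \<in> A})"

text \<open>\<open>occupied n w i\<close> is the set of spots taken by cars \<open>1, \<dots>, i\<close> when car \<open>j\<close> follows the
  trajectory \<open>w j\<close>, and \<open>None\<close> if one of these cars fails to park; from then on no car enters.\<close>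

fun occupied :: "nat \<Rightarrow> (nat \<Rightarrow> nat \<Rightarrow> int) \<Rightarrow> nat \<Rightarrow> int set option" where
  "occupied n w 0 = Some {}"
| "occupied n w (Suc i) =
    (case occupied n w i of
       None \<Rightarrow> None
     | Some S \<Rightarrow>
        (case hitting_time (w (Suc i)) ({1..int n} - S) of
           enat t \<Rightarrow> Some (insert (w (Suc i) t) S)
         | \<infinity> \<Rightarrow> None))"

definition all_park :: "nat \<Rightarrow> (nat \<Rightarrow> nat) \<Rightarrow> (nat \<Rightarrow> nat \<Rightarrow> 'a \<Rightarrow> int) \<Rightarrow> 'a \<Rightarrow> nat" where
  "all_park n \<alpha> \<xi> \<omega> = of_bool (occupied n (walk \<alpha> \<xi> \<omega>) n \<noteq> None)"

definition parking_time :: "nat \<Rightarrow> (nat \<Rightarrow> nat) \<Rightarrow> (nat \<Rightarrow> nat \<Rightarrow> 'a \<Rightarrow> int) \<Rightarrow> 'a \<Rightarrow> enat" where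
  "parking_time n \<alpha> \<xi> \<omega> = (\<Sum>i = 1..n. hitting_time (walk \<alpha> \<xi> \<omega> i) {int i})"

text \<open>The value at \<open>\<infinity>\<close> is the dummy \<open>0\<close>.\<close>

definition real_parking_time ::
    "nat \<Rightarrow> (nat \<Rightarrow> nat) \<Rightarrow> (nat \<Rightarrow> nat \<Rightarrow> 'a \<Rightarrow> int) \<Rightarrow> 'a \<Rightarrow> real" where
  "real_parking_time n \<alpha> \<xi> \<omega> = real_of_ereal (ereal_of_enat (parking_time n \<alpha> \<xi> \<omega>))"

text \<open>Sanity check for \<open>parking_time\<close>: as long as no car has failed, the time car \<open>i\<close> searches
  for an unoccupied spot is the time it first hits \<open>i\<close>.\<close>

lemma hitting_time_eq_enat:
  "hitting_time w A = enat t \<longleftrightarrow> w t \<in> A \<and> (\<forall>s<t. w s \<notin> A)"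
proof
  assume h: "hitting_time w A = enat t"
  then have ne: "{t. w t \<in> A} \<noteq> {}"
    by (auto simp: hitting_time_def Inf_enat_def split: if_splits)
  then have "enat t \<in> enat ` {t. w t \<in> A}"
    using h unfolding hitting_time_def by (metis Inf_enat_def LeastI_ex empty_is_image ex_in_conv)
  moreover have "\<forall>s<t. w s \<notin> A"
    using h unfolding hitting_time_def
    by (metis Inf_lower enat_ord_simps(1) image_eqI mem_Collect_eq not_le)
  ultimately show "w t \<in> A \<and> (\<forall>s<t. w s \<notin> A)" by auto
next
  assume h: "w t \<in> A \<and> (\<forall>s<t. w s \<notin> A)"
  show "hitting_time w A = enat t"
    unfolding hitting_time_def
    using h by (intro antisym Inf_lower Inf_greatest) (auto simp: not_less[symmetric])
qed

lemma hitting_time_upward: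
  assumes "w 0 \<le> a" and "\<And>t. w (Suc t) \<le> w t + 1" and "a \<le> b"
  shows "hitting_time w {a..b} = hitting_time w {a}"
proof -
  have low: "w t < a" if "\<forall>s<t. w s \<noteq> a" "w t \<noteq> a" for t
    using that
  proof (induction t)
    case 0
    then show ?case using assms(1) by simp
  next
    case (Suc t)
    then have "w t < a" by simp
    then show ?case using assms(2)[of t] Suc.prems(2) by linarith
  qed
  have eq: "w t = a" if "w t \<in> {a..b}" "\<forall>s<t. w s \<notin> {a..b}" for t
    using low[of t] that assms(3) by force
  have eq2: "w s \<notin> {a..b}" if "\<forall>s<t. w s \<noteq> a" "s < t" for s t
    using low[of s] that by force
  have "hitting_time w {a..b} = enat t \<longleftrightarrow> hitting_time w {a} = enat t" for t
    unfolding hitting_time_eq_enat using eq[of t] eq2[of t] assms(3) by fastforce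
  then show ?thesis by (metis not_enat_eq)
qed

lemma hitting_time_unoccupied:
  assumes "occupied n w i = Some S" and "i < n"
    and "\<And>j. j \<in> {1..n} \<Longrightarrow> w j 0 \<le> int j"
    and "\<And>j t. j \<in> {1..n} \<Longrightarrow> w j (Suc t) - w j t \<in> {-1, 1}"
  shows "S = {1..int i} \<and>
    hitting_time (w (Suc i)) ({1..int n} - S) = hitting_time (w (Suc i)) {int (Suc i)}"
  using assms(1,2)
proof (induction i arbitrary: S)
  case (0 S)
  have "w (Suc 0) (Suc t) \<le> w (Suc 0) t + 1" for t
    using assms(4)[of "Suc 0" t] 0 by auto
  then show ?case using 0 assms(3)[of "Suc 0"] hitting_time_upward[of "w (Suc 0)" 1 "int n"] by simp
next
  case (Suc i S)
  obtain S' t where S': "occupied n w i = Some S'"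
    and t: "hitting_time (w (Suc i)) ({1..int n} - S') = enat t"
    and S: "S = insert (w (Suc i) t) S'"
    using Suc.prems(1) by (auto split: option.splits enat.splits)
  have IH: "S' = {1..int i}" "hitting_time (w (Suc i)) {int (Suc i)} = enat t"
    using Suc.IH[OF S'] Suc.prems(2) t by auto
  have "w (Suc i) t = int (Suc i)" using IH(2) by (simp add: hitting_time_eq_enat)
  then have S1: "S = {1..int (Suc i)}" using S IH(1) by auto
  have "{1..int n} - S = {int (Suc (Suc i))..int n}" using S1 by auto
  moreover have "w (Suc (Suc i)) (Suc t) \<le> w (Suc (Suc i)) t + 1" for t
    using assms(4)[of "Suc (Suc i)" t] Suc.prems(2) by auto
  ultimately show ?case
    using S1 assms(3)[of "Suc (Suc i)"] Suc.prems(2)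
      hitting_time_upward[of "w (Suc (Suc i))" "int (Suc (Suc i))" "int n"] by simp
qed

end

theory Submission imports Defs "HOL-Real_Asymp.Real_Asymp" begin

text \<open>
  The proof rests on a decoupling. Since every car prefers a spot not beyond its own number and moves by unit
  steps, the spots are filled in the order \<open>1, 2, \<dots>\<close>: car \<open>i\<close> parks iff its walk ever reaches \<open>i\<close>
  (lemma \<open>occupied_iff_all_hit\<close>). The walks of different cars are independent, so the probability that all cars
  park is the product over \<open>i\<close> of the probabilities that a walk ever gains height \<open>d i\<close>, and mean and
  variance of the total time are the sums over \<open>i\<close> of mean and variance of the time needed to gain
  height \<open>d i\<close>. It remains to study a single walk.

  For a single walk, conditioning on the first step shows that the probability of gaining height \<open>d\<close> within \<open>N\<close> steps obeys the recursion
  \<open>hit_by\<close> (lemma \<open>first_passage\<close>). The hitting probability is the limit of these numbers as \<open>N\<close> grows; for \<open>p > 1/2\<close>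
  the first two moments of the hitting time are the sums of the tails \<open>1 - hit_by p k d\<close> with weights \<open>1\<close>
  and \<open>2 * k + 1\<close>. Each of these three limits solves a second-order difference equation in \<open>d\<close>
  \<open>F d = c d + p * F (d - 1) + (1 - p) * F (d + 1)\<close>
  with \<open>c = 0\<close>, \<open>c = 1\<close> and \<open>c = 2 * d / (2 * p - 1) - 1\<close> respectively, and the boundary value at \<open>0\<close> is given.
  The second boundary condition comes from growth: for \<open>p < 1\<close> two solutions differ by a multiple of the geometric
  sum \<open>\<Sum>k<d. (p / (1 - p)) ^ k\<close>, whereas the limits in question are squeezed between \<open>0\<close> and an explicit
  solution that is negligible against this sum (lemmas \<open>harmonic_eq_0\<close> and \<open>poisson_limit\<close>). The explicit
  solutions are
  \<open>1\<close> or \<open>(p / (1 - p)) ^ d\<close> for the probability, \<open>d / (2 * p - 1)\<close> for the mean, and the square of the mean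
  plus \<open>4 * p * (1 - p) * d / (2 * p - 1) ^ 3\<close> for the second moment.
\<close>

section \<open>The Poisson equation of the walk on the half-line\<close>

text \<open>\<open>hit_by p N d\<close> is the probability that the walk gains height \<open>d\<close> within its first \<open>N\<close> steps,
  written as the recursion obtained by conditioning on the first step. That the random walk really
  has these probabilities is lemma \<open>first_passage\<close> below; everything in this part is about numbers only.\<close>

fun hit_by :: "real \<Rightarrow> nat \<Rightarrow> nat \<Rightarrow> real" where
  "hit_by p N 0 = 1"
| "hit_by p 0 (Suc d) = 0"
| "hit_by p (Suc N) (Suc d) = p * hit_by p N d + (1 - p) * hit_by p N (Suc (Suc d))"

text \<open>The increments of a harmonic function form a geometric sequence with ratio \<open>p / (1 - p)\<close>, so with
  boundary value \<open>0\<close> such a function is a multiple of \<open>\<Sum>k<d. (p / (1 - p)) ^ k\<close>. Growing more slowly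
  than this sum forces the multiple to be zero. The sum tends to a finite limit for \<open>p < 1/2\<close>, is
  linear for \<open>p = 1/2\<close> and exponential for \<open>p > 1/2\<close>; phrasing the growth condition through the sum
  itself lets one lemma serve all three regimes. For \<open>p = 1\<close> a harmonic function is constant
  without any condition.\<close>

lemma harmonic_eq_0:
  fixes V :: "nat \<Rightarrow> real"
  assumes "V 0 = 0"
    and harm: "\<And>d. V (Suc d) = p * V d + (1 - p) * V (Suc (Suc d))"
    and "p \<le> 1"
    and growth: "p < 1 \<Longrightarrow> (\<lambda>d. V d / (\<Sum>k<d. (p / (1 - p)) ^ k)) \<longlonglongrightarrow> 0"
    and "0 \<le> p"
  shows "V d = 0"
proof (cases "p = 1")
  case True
  then have "V (Suc d) = V d" for d using harm[of d] True by simp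
  then show ?thesis using \<open>V 0 = 0\<close> by (induction d) auto
next
  case False
  then have p: "p < 1" using \<open>p \<le> 1\<close> by simp
  define r where "r = p / (1 - p)"
  have "0 \<le> r" using p \<open>0 \<le> p\<close> by (simp add: r_def)
  have pos: "0 < (\<Sum>k<Suc d. r ^ k)" for d
    unfolding sum.lessThan_Suc_shift using \<open>0 \<le> r\<close> by (simp add: add_pos_nonneg sum_nonneg)
  have diff: "V (Suc d) - V d = r ^ d * V 1" for d
  proof (induction d)
    case 0
    then show ?case using \<open>V 0 = 0\<close> by simp
  next
    case (Suc d)
    have "(1 - p) * (V (Suc (Suc d)) - V (Suc d)) = p * (V (Suc d) - V d)"
      using harm[of d] by (simp add: algebra_simps)
    then have "V (Suc (Suc d)) - V (Suc d) = r * (V (Suc d) - V d)"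
      using p by (simp add: r_def divide_simps mult.commute)
    then show ?case using Suc by simp
  qed
  have V: "V d = V 1 * (\<Sum>k<d. r ^ k)" for d
  proof (induction d)
    case (Suc d)
    have "V (Suc d) = V d + r ^ d * V 1" using diff[of d] by simp
    also have "\<dots> = V 1 * (\<Sum>k<d. r ^ k) + r ^ d * V 1" by (simp only: Suc)
    finally show ?case by (simp add: algebra_simps)
  qed (simp add: \<open>V 0 = 0\<close>)
  have "eventually (\<lambda>d. V d / (\<Sum>k<d. r ^ k) = V 1) sequentially"
  proof (rule eventually_sequentiallyI)
    fix d :: nat assume "1 \<le> d"
    then obtain d' where "d = Suc d'" by (cases d) auto
    then have "(\<Sum>k<d. r ^ k) \<noteq> 0" using pos[of d'] by simp
    then have "V 1 * (\<Sum>k<d. r ^ k) / (\<Sum>k<d. r ^ k) = V 1"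
      by (rule nonzero_mult_div_cancel_right)
    moreover note V[of d]
    ultimately show "V d / (\<Sum>k<d. r ^ k) = V 1" by metis
  qed
  then have "(\<lambda>d. V d / (\<Sum>k<d. r ^ k)) \<longlonglongrightarrow> V 1" by (rule tendsto_eventually)
  with growth[OF p] have "V 1 = 0" unfolding r_def by (metis LIMSEQ_unique)
  then show ?thesis using V[of d] by simp
qed

text \<open>Functionals of the first \<open>N\<close> steps satisfy the Poisson equation only in the time-dependent form
  \<open>step\<close>. A solution \<open>F\<close> of the stationary equation dominates them, by induction on \<open>N\<close>, hence they
  increase to some limit \<open>L \<le> F\<close>, which solves the stationary equation too. Then \<open>F - L\<close> is harmonic,
  vanishes at \<open>0\<close> and lies between \<open>0\<close> and \<open>F\<close>, so it is zero if \<open>F\<close> grows slowly enough.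
  The lemma is applied with \<open>F\<close> the hitting probability, the mean and the second moment of the
  hitting time; each time it suffices to guess \<open>F\<close> and to check its equation.\<close>

lemma poisson_limit:
  fixes G c :: "nat \<Rightarrow> nat \<Rightarrow> real" and F c' :: "nat \<Rightarrow> real"
  assumes p: "0 \<le> p" "p \<le> 1"
    and init: "\<And>d. 0 \<le> G 0 d" "\<And>d. G 0 d \<le> F d"
    and bdry: "\<And>N. G N 0 = F 0"
    and mono: "\<And>d. incseq (\<lambda>N. G N d)"
    and step: "\<And>N d. G (Suc N) (Suc d) = c N d + p * G N d + (1 - p) * G N (Suc (Suc d))"
    and c: "\<And>N d. c N d \<le> c' d" "\<And>d. (\<lambda>N. c N d) \<longlonglongrightarrow> c' d"
    and F: "\<And>d. F (Suc d) = c' d + p * F d + (1 - p) * F (Suc (Suc d))"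
    and growth: "p < 1 \<Longrightarrow> (\<lambda>d. F d / (\<Sum>k<d. (p / (1 - p)) ^ k)) \<longlonglongrightarrow> 0"
  shows "(\<lambda>N. G N d) \<longlonglongrightarrow> F d"
proof -
  have le: "G N d \<le> F d" for N d
  proof (induction N arbitrary: d)
    case (Suc N)
    show ?case
    proof (cases d)
      case d: (Suc e)
      have "p * G N e \<le> p * F e" "(1 - p) * G N (Suc (Suc e)) \<le> (1 - p) * F (Suc (Suc e))"
        using Suc.IH p by (auto intro: mult_left_mono)
      then show ?thesis
        unfolding d step[of N e] F[of e] using c(1)[of N e] by linarith
    qed (simp add: bdry)
  qed (rule init)
  have ge: "0 \<le> G N d" for N d
    using init(1)[of d] incseqD[OF mono[of d], of 0 N] by simp
  have "\<exists>l. (\<lambda>N. G N d) \<longlonglongrightarrow> l" for d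
  proof (rule incseq_convergent[OF mono[of d]])
    show "\<forall>N. G N d \<le> F d" using le by simp
  qed (rule exI)
  then obtain L where L: "\<And>d. (\<lambda>N. G N d) \<longlonglongrightarrow> L d"
    using choice[of "\<lambda>d l. (\<lambda>N. G N d) \<longlonglongrightarrow> l"] by blast
  have L0: "0 \<le> L d" for d by (rule LIMSEQ_le_const[OF L]) (use ge in auto)
  have LF: "L d \<le> F d" for d by (rule LIMSEQ_le_const2[OF L]) (use le in auto)
  have Lstep: "L (Suc d) = c' d + p * L d + (1 - p) * L (Suc (Suc d))" for d
  proof -
    have "(\<lambda>N. G (Suc N) (Suc d)) \<longlonglongrightarrow> c' d + p * L d + (1 - p) * L (Suc (Suc d))"
      unfolding step by (intro tendsto_intros c L)
    with LIMSEQ_Suc[OF L[of "Suc d"]] show ?thesis by (rule LIMSEQ_unique)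
  qed
  have "F d - L d = 0"
  proof (rule harmonic_eq_0[of "\<lambda>d. F d - L d" p])
    have "(\<lambda>N. G N 0) \<longlonglongrightarrow> F 0" by (simp add: bdry)
    then show "F 0 - L 0 = 0" using LIMSEQ_unique[OF L[of 0]] by simp
    show "F (Suc d) - L (Suc d) = p * (F d - L d) + (1 - p) * (F (Suc (Suc d)) - L (Suc (Suc d)))" for d
      by (subst F, subst Lstep) (simp add: algebra_simps)
    show "(\<lambda>d. (F d - L d) / (\<Sum>k<d. (p / (1 - p)) ^ k)) \<longlonglongrightarrow> 0" if "p < 1"
    proof (rule tendsto_sandwich[OF _ _ tendsto_const growth[OF that]])
      have S: "0 \<le> (\<Sum>k<d. (p / (1 - p)) ^ k)" for d
        using p that by (intro sum_nonneg) auto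
      show "\<forall>\<^sub>F d in sequentially. 0 \<le> (F d - L d) / (\<Sum>k<d. (p / (1 - p)) ^ k)"
        using S LF by (auto intro!: always_eventually divide_nonneg_nonneg)
      show "\<forall>\<^sub>F d in sequentially. (F d - L d) / (\<Sum>k<d. (p / (1 - p)) ^ k)
          \<le> F d / (\<Sum>k<d. (p / (1 - p)) ^ k)"
        using S L0 by (auto intro!: always_eventually divide_right_mono)
    qed
  qed (use p in auto)
  then show ?thesis using L[of d] by simp
qed

lemma hit_by_nonneg: "0 \<le> p \<Longrightarrow> p \<le> 1 \<Longrightarrow> 0 \<le> hit_by p N d"
  by (induction p N d rule: hit_by.induct) auto

lemma hit_by_le_1: "0 \<le> p \<Longrightarrow> p \<le> 1 \<Longrightarrow> hit_by p N d \<le> 1"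
proof (induction p N d rule: hit_by.induct)
  case (3 p N d)
  then show ?case using convex_bound_le[of "hit_by p N d" 1 "hit_by p N (Suc (Suc d))" p "1 - p"]
    by simp
qed auto

lemma incseq_hit_by: 
  assumes "0 \<le> p" "p \<le> 1" shows "incseq (\<lambda>N. hit_by p N d)"
proof (rule incseq_SucI)
  fix N show "hit_by p N d \<le> hit_by p (Suc N) d"
    using assms
  proof (induction p N d rule: hit_by.induct)
    case (3 p N d)
    then show ?case by (auto intro!: add_mono mult_left_mono simp del: hit_by.simps simp: hit_by.simps(3))
  qed (auto simp: hit_by_nonneg)
qed

lemma geometric_sum_ge:
  assumes "1 \<le> (r::real)" shows "real d \<le> (\<Sum>k<d. r ^ k)"
  using sum_mono[of "{..<d}" "\<lambda>_. 1" "\<lambda>k. r ^ k"] assms by simp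

text \<open>For \<open>p < 1\<close> both \<open>1\<close> and \<open>(p / (1 - p)) ^ d\<close> are harmonic with value \<open>1\<close> at the boundary. The growth condition
  decides which of them is the hitting probability: it admits the constant exactly when the walk does not drift
  downwards, and the decaying power when it does.\<close>

lemma hit_by_limit:
  assumes "0 \<le> p" "p \<le> 1"
  shows "(\<lambda>N. hit_by p N d) \<longlonglongrightarrow> (if 1/2 \<le> p then 1 else (p / (1 - p)) ^ d)"
proof (rule poisson_limit[where F = "\<lambda>d. if 1/2 \<le> p then 1 else (p / (1 - p)) ^ d" and c = "\<lambda>_ _. 0" and c' = "\<lambda>_. 0" and p = p])
  show "hit_by p 0 d \<le> (if 1/2 \<le> p then 1 else (p / (1 - p)) ^ d)" for d
    using assms by (cases d) auto
  show "(\<lambda>d. (if 1/2 \<le> p then 1 else (p / (1 - p)) ^ d) / (\<Sum>k<d. (p / (1 - p)) ^ k)) \<longlonglongrightarrow> 0"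
    if "p < 1"
  proof (cases "1/2 \<le> p")
    case True
    then have r: "1 \<le> p / (1 - p)" using that by (simp add: field_simps)
    have "(\<lambda>d. 1 / (\<Sum>k<d. (p / (1 - p)) ^ k)) \<longlonglongrightarrow> 0"
    proof (rule tendsto_sandwich[OF _ _ tendsto_const lim_1_over_n])
      show "\<forall>\<^sub>F d in sequentially. 0 \<le> 1 / (\<Sum>k<d. (p / (1 - p)) ^ k)"
        using r by (intro always_eventually allI divide_nonneg_nonneg sum_nonneg) auto
      have "1 / (\<Sum>k<d. (p / (1 - p)) ^ k) \<le> 1 / of_nat d" if "1 \<le> d" for d
        by (rule frac_le) (use geometric_sum_ge[OF r, of d] that in auto)
      then show "\<forall>\<^sub>F d in sequentially. 1 / (\<Sum>k<d. (p / (1 - p)) ^ k) \<le> 1 / of_nat d"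
        by (rule eventually_sequentiallyI)
    qed
    then show ?thesis using True by simp
  next
    case False
    define r where "r = p / (1 - p)"
    have r: "0 \<le> r" "r < 1" using False assms by (auto simp: field_simps r_def)
    have pos: "1 \<le> (\<Sum>k<d. r ^ k)" if "1 \<le> d" for d
      using that r member_le_sum[of 0 "{..<d}" "\<lambda>k. r ^ k"] by auto
    have "(\<lambda>d. r ^ d / (\<Sum>k<d. r ^ k)) \<longlonglongrightarrow> 0"
    proof (rule tendsto_sandwich[OF _ _ tendsto_const LIMSEQ_realpow_zero[OF r]])
      show "\<forall>\<^sub>F d in sequentially. 0 \<le> r ^ d / (\<Sum>k<d. r ^ k)"
        using r by (intro always_eventually allI divide_nonneg_nonneg sum_nonneg) auto
      have "r ^ d / (\<Sum>k<d. r ^ k) \<le> r ^ d" if "1 \<le> d" for d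
        using divide_left_mono[of 1 _ "r^d", OF pos[OF that]] pos[OF that] r by simp
      then show "\<forall>\<^sub>F d in sequentially. r ^ d / (\<Sum>k<d. r ^ k) \<le> r ^ d"
        by (rule eventually_sequentiallyI)
    qed
    then show ?thesis using False by (simp add: r_def)
  qed
  show "(if 1/2 \<le> p then 1 else (p / (1 - p)) ^ Suc d) = 0 + p * (if 1/2 \<le> p then 1 else (p / (1 - p)) ^ d)
     + (1 - p) * (if 1/2 \<le> p then 1 else (p / (1 - p)) ^ Suc (Suc d))" for d
  proof (cases "1/2 \<le> p")
    case False
    define r where "r = p / (1 - p)"
    have r: "(1 - p) * r = p" using False by (simp add: r_def)
    have "p * r ^ d + (1 - p) * r ^ Suc (Suc d) = r ^ d * (p + ((1 - p) * r) * r)"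
      by (simp add: algebra_simps)
    also have "\<dots> = r ^ d * (((1 - p) * r) + p * r)"
      by (simp only: r)
    also have "\<dots> = r ^ Suc d"
      by (simp add: algebra_simps)
    finally show ?thesis using False by (simp add: r_def)
  qed simp
qed (use assms in \<open>auto simp: hit_by_nonneg incseq_hit_by\<close>)

lemma quadratic_over_geometric_sum:
  assumes "1 < (r::real)"
  shows "(\<lambda>d. (a * real d + b * (real d)\<^sup>2) / (\<Sum>k<d. r ^ k)) \<longlonglongrightarrow> 0"
proof -
  have "(\<lambda>d. (a * real d + b * (real d)\<^sup>2) / ((r ^ d - 1) / (r - 1))) \<longlonglongrightarrow> 0"
    using assms by real_asymp
  then show ?thesis using assms by (simp add: geometric_sum)
qed

text \<open>Summing the tails \<open>1 - hit_by p k d\<close> of the hitting time over \<open>k\<close> gives its mean; the partial sums satisfy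
  the Poisson equation with source \<open>1\<close>, one unit of time per step, and drift \<open>2 * p - 1\<close> per step
  makes \<open>real d / (2 * p - 1)\<close> a solution.\<close>

lemma hit_by_tail_sum:
  assumes "1/2 < p" "p \<le> 1"
  shows "(\<lambda>k. 1 - hit_by p k d) sums (real d / (2 * p - 1))"
  unfolding sums_def
proof (rule poisson_limit[where G = "\<lambda>N d. \<Sum>k<N. 1 - hit_by p k d" and c = "\<lambda>_ _. 1" and c' = "\<lambda>_. 1" and p = p])
  have "1 < p / (1 - p)" if "p < 1" using assms that by (simp add: field_simps)
  then show "(\<lambda>d. real d / (2 * p - 1) / (\<Sum>k<d. (p / (1 - p)) ^ k)) \<longlonglongrightarrow> 0" if "p < 1"
    using quadratic_over_geometric_sum[of "p / (1 - p)" "1 / (2 * p - 1)" 0] that by simp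
  show "(\<Sum>k<Suc N. 1 - hit_by p k (Suc d)) = 1 + p * (\<Sum>k<N. 1 - hit_by p k d)
      + (1 - p) * (\<Sum>k<N. 1 - hit_by p k (Suc (Suc d)))" for N d
    unfolding sum.lessThan_Suc_shift
    by (simp add: sum_distrib_left sum.distrib[symmetric] algebra_simps)
  show "real (Suc d) / (2 * p - 1) = 1 + p * (real d / (2 * p - 1)) + (1 - p) * (real (Suc (Suc d)) / (2 * p - 1))" for d
  proof -
    define s where "s = 1 / (2 * p - 1)"
    have s: "s * (2 * p - 1) = 1" "\<And>y. y / (2 * p - 1) = y * s"
      using assms by (auto simp: s_def)
    have "real (Suc d) * s - (1 + p * (real d * s) + (1 - p) * (real (Suc (Suc d)) * s)) = s * (2 * p - 1) - 1"
      by (simp add: algebra_simps)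
    then show ?thesis unfolding s(2) s(1) by simp
  qed
qed (use assms in \<open>auto intro!: incseq_SucI simp: hit_by_le_1\<close>)

text \<open>Weighting the \<open>k\<close>-th tail by \<open>(k + 1)\<^sup>2 - k\<^sup>2 = 2 * k + 1\<close> gives the second moment instead. Shifting
  the weight by one step, \<open>2 * (k + 1) + 1 = (2 * k + 1) + 2\<close>, produces twice the unweighted sum
  as the source term, which is why the source depends on \<open>N\<close> here and converges by \<open>hit_by_tail_sum\<close>.\<close>

lemma hit_by_weighted_tail_sum:
  assumes "1/2 < p" "p \<le> 1"
  shows "(\<lambda>k. real (2 * k + 1) * (1 - hit_by p k d)) sums
    (4 * p * (1 - p) / (2 * p - 1) ^ 3 * real d + (real d / (2 * p - 1))\<^sup>2)"
  unfolding sums_def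
proof (rule poisson_limit[where G = "\<lambda>N d. \<Sum>k<N. real (2 * k + 1) * (1 - hit_by p k d)"
      and c = "\<lambda>N d. 2 * (\<Sum>k<Suc N. 1 - hit_by p k (Suc d)) - 1"
      and c' = "\<lambda>d. 2 * (real (Suc d) / (2 * p - 1)) - 1" and p = p
      and F = "\<lambda>d. 4 * p * (1 - p) / (2 * p - 1) ^ 3 * real d + (real d / (2 * p - 1))\<^sup>2"])
  let ?u = "\<lambda>k d. 1 - hit_by p k d"
  have "1 < p / (1 - p)" if "p < 1" using assms that by (simp add: field_simps)
  then show "(\<lambda>d. (4 * p * (1 - p) / (2 * p - 1) ^ 3 * real d + (real d / (2 * p - 1))\<^sup>2) / (\<Sum>k<d. (p / (1 - p)) ^ k)) \<longlonglongrightarrow> 0" if "p < 1"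
    using quadratic_over_geometric_sum[of "p / (1 - p)" "4 * p * (1 - p) / (2 * p - 1) ^ 3" "1 / (2 * p - 1)^2"] that by (simp add: power_divide)
  have lim: "(\<lambda>N. \<Sum>k<N. ?u k (Suc d)) \<longlonglongrightarrow> real (Suc d) / (2 * p - 1)" for d
    using hit_by_tail_sum[OF assms, of "Suc d"] by (simp add: sums_def)
  show "(\<lambda>N. 2 * (\<Sum>k<Suc N. ?u k (Suc d)) - 1) \<longlonglongrightarrow> 2 * (real (Suc d) / (2 * p - 1)) - 1" for d
    by (intro tendsto_intros LIMSEQ_Suc[OF lim])
  have "(\<Sum>k<Suc N. ?u k (Suc d)) \<le> real (Suc d) / (2 * p - 1)" for N d
    using assms by (intro incseq_le[OF _ lim, of d "Suc N"] incseq_SucI) (simp add: hit_by_le_1)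
  then show "2 * (\<Sum>k<Suc N. ?u k (Suc d)) - 1 \<le> 2 * (real (Suc d) / (2 * p - 1)) - 1" for N d
    by (simp only: diff_right_mono mult_left_mono zero_le_numeral)
  show "(\<Sum>k<Suc N. real (2 * k + 1) * ?u k (Suc d)) = 2 * (\<Sum>k<Suc N. ?u k (Suc d)) - 1
      + p * (\<Sum>k<N. real (2 * k + 1) * ?u k d) + (1 - p) * (\<Sum>k<N. real (2 * k + 1) * ?u k (Suc (Suc d)))" for N d
    unfolding sum.lessThan_Suc_shift
    by (simp add: sum_distrib_left sum.distrib[symmetric] algebra_simps)
  show "4 * p * (1 - p) / (2 * p - 1) ^ 3 * real (Suc d) + (real (Suc d) / (2 * p - 1))\<^sup>2
     = 2 * (real (Suc d) / (2 * p - 1)) - 1 + p * (4 * p * (1 - p) / (2 * p - 1) ^ 3 * real d + (real d / (2 * p - 1))\<^sup>2)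
     + (1 - p) * (4 * p * (1 - p) / (2 * p - 1) ^ 3 * real (Suc (Suc d)) + (real (Suc (Suc d)) / (2 * p - 1))\<^sup>2)" for d
  proof -
    \<comment> \<open>With \<open>s = 1 / m\<close> the claim becomes a polynomial identity modulo \<open>s * m = 1\<close> and \<open>v * m = s\<^sup>2 - 1\<close>.\<close>
    define m where "m = 2 * p - 1"
    define v where "v = 4 * p * (1 - p) / m ^ 3"
    define s where "s = 1 / m"
    have "m \<noteq> 0" using assms by (simp add: m_def)
    have "4 * p * (1 - p) = 1 - m\<^sup>2" by (simp add: m_def power2_eq_square algebra_simps)
    then have "v = (1 - m\<^sup>2) / m ^ 3" by (simp add: v_def)
    then have v: "v * m = s\<^sup>2 - 1"
      using \<open>m \<noteq> 0\<close> by (simp add: s_def power2_eq_square power3_eq_cube field_simps)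
    have s: "s * m = 1" "\<And>y. y / m = y * s" using \<open>m \<noteq> 0\<close> by (auto simp: s_def)
    have "v * real (Suc d) + (real (Suc d) * s)\<^sup>2 - (2 * (real (Suc d) * s) - 1
        + p * (v * real d + (real d * s)\<^sup>2)
        + (1 - p) * (v * real (Suc (Suc d)) + (real (Suc (Suc d)) * s)\<^sup>2))
      = (v * m - s\<^sup>2 + 1) + (s * m - 1) * (2 * s * real d + 2 * s)"
      unfolding m_def by (simp add: power2_eq_square algebra_simps)
    also have "\<dots> = 0" unfolding v s(1) by simp
    finally show ?thesis unfolding m_def[symmetric] v_def[symmetric] s(2) by simp
  qed
qed (use assms in \<open>auto intro!: incseq_SucI simp: hit_by_le_1\<close>)

section \<open>Probabilistic preliminaries\<close>

lemma (in prob_space) indep_vars_reindex: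
  assumes "indep_vars (\<lambda>_. N) X I" and "inj_on f J" and "f ` J \<subseteq> I"
  shows "indep_vars (\<lambda>_. N) (\<lambda>j. X (f j)) J"
proof -
  have "indep_vars (\<lambda>j. PiM {f j} (\<lambda>_. N)) (\<lambda>j \<omega>. restrict (\<lambda>i. X i \<omega>) {f j}) J"
    using assms by (intro indep_vars_restrict) (auto simp: disjoint_family_on_def inj_on_def)
  then have "indep_vars (\<lambda>_. N) (\<lambda>j \<omega>. (restrict (\<lambda>i. X i \<omega>) {f j}) (f j)) J"
    by (rule indep_vars_compose2) simp
  then show ?thesis by simp
qed

text \<open>Induction on the index set: the new summand is independent of the sum of the others, so the cross
  term of the square factorises and cancels against the one in the square of the mean.\<close>

lemma (in prob_space) variance_sum:
  fixes X :: "'i \<Rightarrow> 'a \<Rightarrow> real"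
  assumes "finite I" and ind: "indep_vars (\<lambda>_. borel) X I"
    and int: "\<And>i. i \<in> I \<Longrightarrow> integrable M (X i)"
    and int2: "\<And>i. i \<in> I \<Longrightarrow> integrable M (\<lambda>\<omega>. (X i \<omega>)\<^sup>2)"
  shows "integrable M (\<lambda>\<omega>. (\<Sum>i\<in>I. X i \<omega>)\<^sup>2) \<and>
    variance (\<lambda>\<omega>. \<Sum>i\<in>I. X i \<omega>) = (\<Sum>i\<in>I. variance (X i))"
  using assms
proof (induction I rule: finite_induct)
  case empty
  then show ?case by simp
next
  case (insert i I)
  let ?S = "\<lambda>\<omega>. \<Sum>j\<in>I. X j \<omega>"
  have IH: "integrable M (\<lambda>\<omega>. (?S \<omega>)\<^sup>2)" "variance ?S = (\<Sum>i\<in>I. variance (X i))"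
    using insert.IH[OF indep_vars_subset[OF insert.prems(1)]] insert.prems by auto
  have S: "integrable M ?S" using insert.prems by auto
  have Xi: "integrable M (X i)" "integrable M (\<lambda>\<omega>. (X i \<omega>)\<^sup>2)" using insert.prems by auto
  have iv: "indep_var borel (X i) borel ?S"
    by (rule indep_vars_sum[OF insert.hyps insert.prems(1)])
  note prod = indep_var_lebesgue_integral[OF iv Xi(1) S] indep_var_integrable[OF iv Xi(1) S]
  have sq: "(X i \<omega> + ?S \<omega>)\<^sup>2 = (X i \<omega>)\<^sup>2 + (2 * (X i \<omega> * ?S \<omega>) + (?S \<omega>)\<^sup>2)" for \<omega>
    by (simp add: power2_sum algebra_simps)
  have int_sq: "integrable M (\<lambda>\<omega>. (X i \<omega> + ?S \<omega>)\<^sup>2)"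
    unfolding sq using Xi(2) IH(1) prod(2) by auto
  have E_sq: "expectation (\<lambda>\<omega>. (X i \<omega> + ?S \<omega>)\<^sup>2) =
      expectation (\<lambda>\<omega>. (X i \<omega>)\<^sup>2) + (2 * (expectation (X i) * expectation ?S) + expectation (\<lambda>\<omega>. (?S \<omega>)\<^sup>2))"
    unfolding sq using Xi(2) IH(1) prod by simp
  have E: "expectation (\<lambda>\<omega>. X i \<omega> + ?S \<omega>) = expectation (X i) + expectation ?S"
    using Xi(1) S by (rule Bochner_Integration.integral_add)
  have "variance (\<lambda>\<omega>. X i \<omega> + ?S \<omega>) = expectation (\<lambda>\<omega>. (X i \<omega> + ?S \<omega>)\<^sup>2) - (expectation (\<lambda>\<omega>. X i \<omega> + ?S \<omega>))\<^sup>2"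
    using Xi(1) S int_sq by (intro variance_eq) auto
  also have "\<dots> = (expectation (\<lambda>\<omega>. (X i \<omega>)\<^sup>2) - (expectation (X i))\<^sup>2)
      + (expectation (\<lambda>\<omega>. (?S \<omega>)\<^sup>2) - (expectation ?S)\<^sup>2)"
    unfolding E_sq E by (simp add: power2_sum algebra_simps)
  also have "\<dots> = variance (X i) + variance ?S"
    unfolding variance_eq[OF Xi] variance_eq[OF S IH(1)] ..
  finally have "variance (\<lambda>\<omega>. X i \<omega> + ?S \<omega>) = variance (X i) + variance ?S" .
  then show ?case using insert.hyps int_sq IH(2) by simp
qed

text \<open>Summation by parts in its general form: a function \<open>f\<close> of \<open>T\<close> with increments \<open>w k\<close> is the sum of
  \<open>w k\<close> over all \<open>k\<close> with \<open>k < T\<close>, and the sum can be integrated term by term because \<open>w\<close> is nonnegative.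
  The weights \<open>1\<close> and \<open>2 * k + 1\<close> give the first and the second moment of \<open>T\<close>. The value of \<open>f\<close> where \<open>T = \<infinity>\<close> is
  left open, so that dummy values there do no harm.\<close>

lemma (in prob_space) tail_sum_expectation:
  fixes T :: "'a \<Rightarrow> enat" and w :: "nat \<Rightarrow> real"
  assumes T: "T \<in> measurable M (count_space UNIV)" and fin: "AE \<omega> in M. T \<omega> \<noteq> \<infinity>"
    and w: "\<And>k. 0 \<le> w k"
    and sums: "(\<lambda>k. w k * prob {\<omega> \<in> space M. enat k < T \<omega>}) sums s"
    and f: "f \<in> borel_measurable M" "AE \<omega> in M. \<forall>t. T \<omega> = enat t \<longrightarrow> f \<omega> = (\<Sum>k<t. w k)"
  shows "has_bochner_integral M f s"
proof -
  let ?A = "\<lambda>k. {\<omega> \<in> space M. enat k < T \<omega>}"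
  let ?f = "\<lambda>k \<omega>. w k * indicator (?A k) \<omega> :: real"
  have A: "?A k \<in> sets M" for k using T by measurable
  have int: "integrable M (?f k)" for k
    using A by (auto intro: integrable_real_indicator simp: emeasure_eq_measure)
  have eq: "(\<integral>\<omega>. ?f k \<omega> \<partial>M) = w k * prob (?A k)" for k using A by (simp add: Int_absorb2)
  have norm: "norm (?f k \<omega>) = ?f k \<omega>" for k \<omega> using w by (simp add: abs_mult)
  have AEf: "AE \<omega> in M. (\<lambda>k. ?f k \<omega>) sums f \<omega>"
    using fin f(2) AE_space
  proof eventually_elim
    case (elim \<omega>)
    then obtain t where t: "T \<omega> = enat t" by auto
    have "(\<lambda>k. ?f k \<omega>) sums (\<Sum>k<t. ?f k \<omega>)"
      by (rule sums_finite) (auto simp: t)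
    also have "(\<Sum>k<t. ?f k \<omega>) = (\<Sum>k<t. w k)"
      using elim(3) by (intro sum.cong) (auto simp: t)
    finally show ?case using elim(2) t by simp
  qed
  have summ: "AE \<omega> in M. summable (\<lambda>k. norm (?f k \<omega>))"
    using AEf unfolding norm by eventually_elim (rule sums_summable)
  have summ2: "summable (\<lambda>k. \<integral>\<omega>. norm (?f k \<omega>) \<partial>M)"
    unfolding norm eq using sums by (rule sums_summable)
  have "has_bochner_integral M (\<lambda>\<omega>. \<Sum>k. ?f k \<omega>) s"
    unfolding has_bochner_integral_iff
  proof
    show "integrable M (\<lambda>\<omega>. \<Sum>k. ?f k \<omega>)"
      by (rule integrable_suminf[OF int summ summ2])
    have "(\<lambda>k. \<integral>\<omega>. ?f k \<omega> \<partial>M) sums (\<integral>\<omega>. (\<Sum>k. ?f k \<omega>) \<partial>M)"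
      by (rule sums_integral[OF int summ summ2])
    then show "(\<integral>\<omega>. (\<Sum>k. ?f k \<omega>) \<partial>M) = s"
      unfolding eq using sums by (rule sums_unique2)
  qed
  moreover have "AE \<omega> in M. (\<Sum>k. ?f k \<omega>) = f \<omega>"
    using AEf by eventually_elim (rule sums_unique[symmetric])
  moreover have "(\<lambda>\<omega>. \<Sum>k. ?f k \<omega>) \<in> borel_measurable M"
    using calculation(1) by (rule borel_measurable_has_bochner_integral)
  ultimately show ?thesis
    using has_bochner_integral_cong_AE[OF _ f(1)] by blast
qed

lemma hitting_time_le_iff: "hitting_time w A \<le> enat N \<longleftrightarrow> (\<exists>t\<le>N. w t \<in> A)"
proof (cases "hitting_time w A")
  case (enat t)
  then show ?thesis using hitting_time_eq_enat[of w A t] by (metis enat_ord_simps(1) leI le_trans)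
next
  case infinity
  then have "w t \<notin> A" for t
    unfolding hitting_time_def
    by (metis (mono_tags, lifting) Inf_lower enat.distinct(2) enat_ord_simps(5) image_eqI mem_Collect_eq)
  then show ?thesis using infinity by simp
qed

text \<open>A map into a countable set is measurable as soon as its level sets are; the level sets at finite times
  depend on finitely many positions, and the one at \<open>\<infinity>\<close> is the complement of their union.\<close>

lemma measurable_hitting_time:
  fixes Y :: "nat \<Rightarrow> 'b \<Rightarrow> int"
  assumes [measurable]: "\<And>t. Y t \<in> measurable N (count_space UNIV)"
  shows "(\<lambda>x. hitting_time (\<lambda>t. Y t x) A) \<in> measurable N (count_space UNIV)"
proof -
  have fin: "{x \<in> space N. hitting_time (\<lambda>t. Y t x) A = enat t} \<in> sets N" for t
    unfolding hitting_time_eq_enat by measurable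
  have "hitting_time (\<lambda>t. Y t x) A = \<infinity> \<longleftrightarrow> (\<forall>t. hitting_time (\<lambda>t. Y t x) A \<noteq> enat t)" for x
    by (metis enat.distinct(1) not_infinity_eq)
  then have "{x \<in> space N. hitting_time (\<lambda>t. Y t x) A = \<infinity>}
      = space N - (\<Union>t. {x \<in> space N. hitting_time (\<lambda>t. Y t x) A = enat t})" by auto
  also have "\<dots> \<in> sets N" using fin by auto
  finally have "{x \<in> space N. hitting_time (\<lambda>t. Y t x) A = e} \<in> sets N" for e
    using fin by (cases e) auto
  moreover have "(\<lambda>x. hitting_time (\<lambda>t. Y t x) A) -` {e} \<inter> space N
     = {x \<in> space N. hitting_time (\<lambda>t. Y t x) A = e}" for e by auto
  ultimately show ?thesis
    by (subst measurable_count_space_eq2_countable) auto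
qed

lemma measurable_int_sum:
  fixes Y :: "nat \<Rightarrow> 'b \<Rightarrow> int"
  assumes Y: "\<And>k. Y k \<in> measurable N (count_space UNIV)"
  shows "(\<lambda>x. a + (\<Sum>k<t. Y k x)) \<in> measurable N (count_space UNIV)"
proof (induction t)
  case (Suc t)
  have [measurable]: "Y t \<in> measurable N (count_space UNIV)" 
     "(\<lambda>x. a + (\<Sum>k<t. Y k x)) \<in> measurable N (count_space UNIV)" by fact+
  have "(\<lambda>x. (a + (\<Sum>k<t. Y k x)) + Y t x) \<in> measurable N (count_space UNIV)"
    by measurable
  then show ?case by (simp add: algebra_simps)
qed simp

section \<open>The first passage of a biased walk\<close>

locale biased_steps = prob_space M for M :: "'a measure" +
  fixes p :: real and X :: "nat \<Rightarrow> 'a \<Rightarrow> int"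
  assumes indep: "indep_vars (\<lambda>_. count_space UNIV) X UNIV"
    and up: "\<And>k. prob {\<omega> \<in> space M. X k \<omega> = 1} = p"
    and down: "\<And>k. prob {\<omega> \<in> space M. X k \<omega> = -1} = 1 - p"

lemma (in biased_steps) measurable_step [measurable]: "X k \<in> measurable M (count_space UNIV)"
  using indep by (simp add: indep_vars_def)

lemma (in biased_steps) AE_step: "AE \<omega> in M. \<forall>k. X k \<omega> \<in> {-1, 1}"
  unfolding AE_all_countable
proof
  fix k
  let ?U = "{\<omega> \<in> space M. X k \<omega> = 1}" and ?D = "{\<omega> \<in> space M. X k \<omega> = -1}"
  have U: "?U \<in> events" and D: "?D \<in> events" by measurable
  have "?U \<inter> ?D = {}" by auto
  then have "prob (?U \<union> ?D) = p + (1 - p)"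
    using finite_measure_Union[OF U D] by (simp only: up down)
  then have "prob (?U \<union> ?D) = 1" by simp
  then have "AE \<omega> in M. \<omega> \<in> ?U \<union> ?D"
    by (rule AE_prob_1)
  then show "AE \<omega> in M. X k \<omega> \<in> {-1, 1}" by eventually_elim auto
qed

lemma (in biased_steps) biased_steps_tail: "biased_steps M p (\<lambda>k. X (Suc k))"
  using indep_vars_reindex[OF indep, of Suc UNIV] up down
  by unfold_locales auto

lemma first_step_iff:
  fixes x :: "nat \<Rightarrow> int"
  assumes "x 0 \<in> {-1, 1}"
  shows "(\<exists>t\<le>Suc N. (\<Sum>k<t. x k) = int (Suc d)) \<longleftrightarrow>
     x 0 = 1 \<and> (\<exists>t\<le>N. (\<Sum>k<t. x (Suc k)) = int d) \<or>
     x 0 = -1 \<and> (\<exists>t\<le>N. (\<Sum>k<t. x (Suc k)) = int (Suc (Suc d)))"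
proof -
  have "(\<exists>t\<le>Suc N. (\<Sum>k<t. x k) = int (Suc d)) \<longleftrightarrow> (\<exists>t\<le>N. (\<Sum>k<Suc t. x k) = int (Suc d))"
  proof
    assume "\<exists>t\<le>Suc N. (\<Sum>k<t. x k) = int (Suc d)"
    then obtain t where t: "t \<le> Suc N" "(\<Sum>k<t. x k) = int (Suc d)" by blast
    then show "\<exists>t\<le>N. (\<Sum>k<Suc t. x k) = int (Suc d)" by (cases t) auto
  qed auto
  then show ?thesis unfolding sum.lessThan_Suc_shift using assms by auto
qed

lemma (in biased_steps) measurable_reaches [measurable]:
  "{\<omega> \<in> space M. \<exists>t\<le>N. (\<Sum>k<t. X k \<omega>) = c} \<in> sets M"
proof -
  have [measurable]: "(\<lambda>\<omega>. \<Sum>k<t. X k \<omega>) \<in> measurable M (count_space UNIV)" for t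
    using measurable_int_sum[of X M 0 t] by simp
  show ?thesis by measurable
qed

text \<open>The part of the Markov property that is needed: the first step is independent of
  what the walk does afterwards. The predicate \<open>indep_var\<close> relates variables of one common value type,
  so the later event enters through its integer indicator.\<close>

lemma (in biased_steps) first_step_indep:
  "prob {\<omega> \<in> space M. X 0 \<omega> = a \<and> (\<exists>t\<le>N. (\<Sum>k<t. X (Suc k) \<omega>) = c)}
    = prob {\<omega> \<in> space M. X 0 \<omega> = a} * prob {\<omega> \<in> space M. \<exists>t\<le>N. (\<Sum>k<t. X (Suc k) \<omega>) = c}"
proof -
  let ?C = "\<lambda>_::nat. count_space (UNIV :: int set)"
  let ?R = "\<lambda>\<omega>. \<exists>t\<le>N. (\<Sum>k<t. X (Suc k) \<omega>) = c"
  have "indep_var (PiM {0} ?C) (\<lambda>\<omega>. restrict (\<lambda>i. X i \<omega>) {0}) (PiM {1..} ?C) (\<lambda>\<omega>. restrict (\<lambda>i. X i \<omega>) {1..})"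
    by (rule indep_var_restrict[OF indep]) auto
  moreover have "(\<lambda>x. x 0) \<in> measurable (PiM {0} ?C) (count_space UNIV)" by simp
  moreover have "(\<lambda>x. of_bool (\<exists>t\<le>N. (\<Sum>k<t. x (Suc k)) = c) :: int) \<in> measurable (PiM {1..} ?C) (count_space UNIV)"
  proof -
    have [measurable]: "(\<lambda>x. \<Sum>k<t. x (Suc k)) \<in> measurable (PiM {1..} ?C) (count_space UNIV)" for t
      using measurable_int_sum[of "\<lambda>k x. x (Suc k)" "PiM {1..} ?C" 0 t] by simp
    show ?thesis by measurable
  qed
  ultimately have "indep_var (count_space UNIV) ((\<lambda>x. x 0) \<circ> (\<lambda>\<omega>. restrict (\<lambda>i. X i \<omega>) {0}))
     (count_space UNIV) ((\<lambda>x. of_bool (\<exists>t\<le>N. (\<Sum>k<t. x (Suc k)) = c)) \<circ> (\<lambda>\<omega>. restrict (\<lambda>i. X i \<omega>) {1..}))"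
    by (rule indep_var_compose)
  then have "indep_var (count_space UNIV) (X 0) (count_space UNIV) (\<lambda>\<omega>. of_bool (?R \<omega>))"
    by (simp add: comp_def)
  from indep_varD[OF this, of "{a}" "{1}"]
  have "prob ((\<lambda>\<omega>. (X 0 \<omega>, of_bool (?R \<omega>) :: int)) -` ({a} \<times> {1}) \<inter> space M)
      = prob (X 0 -` {a} \<inter> space M) * prob ((\<lambda>\<omega>. of_bool (?R \<omega>) :: int) -` {1} \<inter> space M)" by simp
  moreover have "(\<lambda>\<omega>. (X 0 \<omega>, of_bool (?R \<omega>) :: int)) -` ({a} \<times> {1}) \<inter> space M = {\<omega> \<in> space M. X 0 \<omega> = a \<and> ?R \<omega>}"
    and "X 0 -` {a} \<inter> space M = {\<omega> \<in> space M. X 0 \<omega> = a}"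
    and "(\<lambda>\<omega>. of_bool (?R \<omega>) :: int) -` {1} \<inter> space M = {\<omega> \<in> space M. ?R \<omega>}" by auto
  ultimately show ?thesis by (simp only:)
qed

text \<open>The first step leads to height \<open>1\<close> or \<open>- 1\<close>, from where the remaining gain is \<open>d - 1\<close> or
  \<open>d + 1\<close>; the later steps form a walk of the same kind, independent of the first one. This is
  the recursion of \<open>hit_by\<close>, so the induction on \<open>N\<close> needs the statement for all walks at once.\<close>

lemma first_passage:
  assumes "biased_steps M p X"
  shows "measure M {\<omega> \<in> space M. \<exists>t\<le>N. (\<Sum>k<t. X k \<omega>) = int d} = hit_by p N d"
  using assms
proof (induction N arbitrary: X d)
  case (0 X d)
  interpret biased_steps M p X by fact
  show ?case by (cases d) (auto simp: prob_space)
next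
  case (Suc N X d)
  interpret biased_steps M p X by fact
  interpret tail: biased_steps M p "\<lambda>k. X (Suc k)" by (rule biased_steps_tail)
  show ?case
  proof (cases d)
    case 0
    have "(\<exists>t\<le>Suc N. (\<Sum>k<t. X k \<omega>) = int d)" for \<omega>
      by (rule exI[of _ 0]) (simp add: 0)
    then show ?thesis by (simp add: 0 prob_space)
  next
    case d: (Suc e)
    let ?R = "\<lambda>c \<omega>. \<exists>t\<le>N. (\<Sum>k<t. X (Suc k) \<omega>) = int c"
    let ?U = "{\<omega> \<in> space M. X 0 \<omega> = 1 \<and> ?R e \<omega>}"
    let ?D = "{\<omega> \<in> space M. X 0 \<omega> = -1 \<and> ?R (Suc (Suc e)) \<omega>}"
    have step: "{\<omega> \<in> space M. X 0 \<omega> = a} \<in> events" for a by measurable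
    have U: "?U \<in> events" and D: "?D \<in> events"
      by - (rule sets.sets_Collect_conj[OF tail.measurable_reaches step])+
    have "prob {\<omega> \<in> space M. \<exists>t\<le>Suc N. (\<Sum>k<t. X k \<omega>) = int d} = prob (?U \<union> ?D)"
    proof (rule finite_measure_eq_AE)
      show "AE \<omega> in M. \<omega> \<in> {\<omega> \<in> space M. \<exists>t\<le>Suc N. (\<Sum>k<t. X k \<omega>) = int d} \<longleftrightarrow> \<omega> \<in> ?U \<union> ?D"
        using AE_step
      proof eventually_elim
        case (elim \<omega>)
        then have "X 0 \<omega> \<in> {-1, 1}" by blast
        from first_step_iff[of "\<lambda>k. X k \<omega>" N e, OF this] show ?case
          unfolding mem_Collect_eq Un_iff d by blast
      qed
      show "{\<omega> \<in> space M. \<exists>t\<le>Suc N. (\<Sum>k<t. X k \<omega>) = int d} \<in> sets M" by (rule measurable_reaches)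
      show "?U \<union> ?D \<in> events" using U D by (rule sets.Un)
    qed
    also have "\<dots> = prob ?U + prob ?D"
      by (rule finite_measure_Union[OF U D]) force
    also have "\<dots> = p * hit_by p N e + (1 - p) * hit_by p N (Suc (Suc e))"
      using first_step_indep[of 1 N "int e"] first_step_indep[of "-1" N "int (Suc (Suc e))"] Suc.IH[OF tail.biased_steps_axioms] by (simp only: up down)
    finally show ?thesis by (simp add: d)
  qed
qed

lemma sum_odd_eq_square: "(\<Sum>k<t. real (2 * k + 1)) = (real t)\<^sup>2"
  by (induction t) (auto simp: power2_eq_square algebra_simps)

context biased_steps
begin

definition passage :: "int \<Rightarrow> nat \<Rightarrow> 'a \<Rightarrow> enat" where
  "passage a d \<omega> = hitting_time (\<lambda>t. a + (\<Sum>k<t. X k \<omega>)) {a + int d}"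

lemma p_bounds: "0 \<le> p" "p \<le> 1"
proof -
  show "0 \<le> p" unfolding up[of 0, symmetric] by (rule measure_nonneg)
  have "0 \<le> 1 - p" unfolding down[of 0, symmetric] by (rule measure_nonneg)
  then show "p \<le> 1" by simp
qed

lemma measurable_passage: "passage a d \<in> measurable M (count_space UNIV)"
proof -
  have "(\<lambda>\<omega>. hitting_time (\<lambda>t. a + (\<Sum>k<t. X k \<omega>)) {a + int d}) \<in> measurable M (count_space UNIV)"
    by (intro measurable_hitting_time measurable_int_sum measurable_step)
  then show ?thesis unfolding passage_def[abs_def] .
qed

lemma prob_passage_le: "prob {\<omega> \<in> space M. passage a d \<omega> \<le> enat N} = hit_by p N d"
proof -
  have "passage a d \<omega> \<le> enat N \<longleftrightarrow> (\<exists>t\<le>N. (\<Sum>k<t. X k \<omega>) = int d)" for \<omega>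
    by (simp add: passage_def hitting_time_le_iff)
  then show ?thesis using first_passage[OF biased_steps_axioms, of N d] by simp
qed

text \<open>The events that the target is reached within \<open>N\<close> steps increase to the event that it is reached at all.\<close>

lemma prob_passage_finite:
  "prob {\<omega> \<in> space M. passage a d \<omega> \<noteq> \<infinity>} = (if 1/2 \<le> p then 1 else (p / (1 - p)) ^ d)"
proof -
  let ?A = "\<lambda>N. {\<omega> \<in> space M. passage a d \<omega> \<le> enat N}"
  have "range ?A \<subseteq> events"
    using measurable_sets[OF measurable_passage, of "{..enat N}" a d for N]
    by (auto simp: vimage_def Int_def conj_commute)
  moreover have "incseq ?A"
    by (rule incseq_SucI) (auto intro: order_trans)
  ultimately have "(\<lambda>N. prob (?A N)) \<longlonglongrightarrow> prob (\<Union>N. ?A N)"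
    by (rule finite_Lim_measure_incseq)
  moreover have "(\<Union>N. ?A N) = {\<omega> \<in> space M. passage a d \<omega> \<noteq> \<infinity>}"
  proof -
    have "(\<exists>N. e \<le> enat N) \<longleftrightarrow> e \<noteq> \<infinity>" for e by (cases e) auto
    then show ?thesis by auto
  qed
  ultimately have "(\<lambda>N. hit_by p N d) \<longlonglongrightarrow> prob {\<omega> \<in> space M. passage a d \<omega> \<noteq> \<infinity>}"
    by (simp only: prob_passage_le)
  from LIMSEQ_unique[OF this hit_by_limit[OF p_bounds]] show ?thesis .
qed

lemma AE_passage_finite:
  assumes "1/2 \<le> p" shows "AE \<omega> in M. passage a d \<omega> \<noteq> \<infinity>"
proof -
  have "prob {\<omega> \<in> space M. passage a d \<omega> \<noteq> \<infinity>} = 1"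
    unfolding prob_passage_finite using assms by simp
  from AE_prob_1[OF this] show ?thesis by eventually_elim simp
qed

lemma prob_passage_greater: "prob {\<omega> \<in> space M. enat N < passage a d \<omega>} = 1 - hit_by p N d"
proof -
  have "{\<omega> \<in> space M. passage a d \<omega> \<le> enat N} \<in> events"
    using measurable_sets[OF measurable_passage, of "{..enat N}" a d]
    by (auto simp: vimage_def Int_def conj_commute)
  moreover have "{\<omega> \<in> space M. enat N < passage a d \<omega>}
      = space M - {\<omega> \<in> space M. passage a d \<omega> \<le> enat N}" by auto
  ultimately show ?thesis by (simp add: prob_compl prob_passage_le)
qed

text \<open>On \<open>passage a d \<omega> = \<infinity>\<close> this has the dummy value \<open>0\<close>, as \<open>real_parking_time\<close> does.\<close>

definition real_passage :: "int \<Rightarrow> nat \<Rightarrow> 'a \<Rightarrow> real" where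
  "real_passage a d \<omega> = real_of_ereal (ereal_of_enat (passage a d \<omega>))"

lemma measurable_real_passage: "real_passage a d \<in> borel_measurable M"
  unfolding real_passage_def[abs_def]
  by (rule measurable_compose[OF measurable_passage]) simp

lemma real_passage_moments:
  assumes "1/2 < p"
  shows "integrable M (real_passage a d)"
    and "expectation (real_passage a d) = real d / (2 * p - 1)"
    and "integrable M (\<lambda>\<omega>. (real_passage a d \<omega>)\<^sup>2)"
    and "variance (real_passage a d) = 4 * p * (1 - p) / (2 * p - 1) ^ 3 * real d"
proof -
  have fin: "AE \<omega> in M. passage a d \<omega> \<noteq> \<infinity>" using assms by (intro AE_passage_finite) simp
  have 1: "has_bochner_integral M (real_passage a d) (real d / (2 * p - 1))"
  proof (rule tail_sum_expectation[OF measurable_passage fin, where w = "\<lambda>_. 1"])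
    show "(\<lambda>k. 1 * prob {\<omega> \<in> space M. enat k < passage a d \<omega>}) sums (real d / (2 * p - 1))"
      using hit_by_tail_sum[OF assms p_bounds(2)] by (simp add: prob_passage_greater)
  qed (auto simp: measurable_real_passage real_passage_def)
  have 2: "has_bochner_integral M (\<lambda>\<omega>. (real_passage a d \<omega>)\<^sup>2)
      (4 * p * (1 - p) / (2 * p - 1) ^ 3 * real d + (real d / (2 * p - 1))\<^sup>2)"
  proof (rule tail_sum_expectation[OF measurable_passage fin, where w = "\<lambda>k. real (2 * k + 1)"])
    show "(\<lambda>k. real (2 * k + 1) * prob {\<omega> \<in> space M. enat k < passage a d \<omega>}) sums
        (4 * p * (1 - p) / (2 * p - 1) ^ 3 * real d + (real d / (2 * p - 1))\<^sup>2)"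
      using hit_by_weighted_tail_sum[OF assms p_bounds(2)] by (simp only: prob_passage_greater)
    show "(\<lambda>\<omega>. (real_passage a d \<omega>)\<^sup>2) \<in> borel_measurable M"
      using measurable_real_passage by simp
    show "AE \<omega> in M. \<forall>t. passage a d \<omega> = enat t \<longrightarrow> (real_passage a d \<omega>)\<^sup>2 = (\<Sum>k<t. real (2 * k + 1))"
      by (intro AE_I2) (simp add: real_passage_def sum_odd_eq_square[symmetric])
  qed simp
  show int: "integrable M (real_passage a d)" and E: "expectation (real_passage a d) = real d / (2 * p - 1)"
    and int2: "integrable M (\<lambda>\<omega>. (real_passage a d \<omega>)\<^sup>2)"
    using 1 2 by (simp_all add: has_bochner_integral_iff)
  show "variance (real_passage a d) = 4 * p * (1 - p) / (2 * p - 1) ^ 3 * real d"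
    unfolding variance_eq[OF int int2] using 2 by (simp add: has_bochner_integral_iff E)
qed

end

section \<open>The parking protocol\<close>

text \<open>Along a trajectory with unit steps that starts at or below its own number, car \<open>i\<close> meets the block \<open>{1..i-1}\<close> of
  occupied spots and can leave it for an unoccupied one only at \<open>i\<close>. So the spots fill up in order, and
  the interaction of the cars disappears.\<close>

lemma occupied_iff_all_hit:
  assumes "m \<le> n"
    and start: "\<And>j. j \<in> {1..n} \<Longrightarrow> w j 0 \<le> int j"
    and steps: "\<And>j t. j \<in> {1..n} \<Longrightarrow> w j (Suc t) - w j t \<in> {-1, 1}"
  shows "occupied n w m \<noteq> None \<longleftrightarrow> (\<forall>i\<in>{1..m}. hitting_time (w i) {int i} \<noteq> \<infinity>)"
  using \<open>m \<le> n\<close>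
proof (induction m)
  case (Suc m)
  show ?case
  proof (cases "occupied n w m")
    case None
    then show ?thesis using Suc by auto
  next
    case (Some S)
    have "hitting_time (w (Suc m)) ({1..int n} - S) = hitting_time (w (Suc m)) {int (Suc m)}"
      by (rule conjunct2[OF hitting_time_unoccupied[OF Some _ start steps]]) (use Suc.prems in simp_all)
    then have "occupied n w (Suc m) \<noteq> None \<longleftrightarrow> hitting_time (w (Suc m)) {int (Suc m)} \<noteq> \<infinity>"
      using Some by (simp split: enat.split)
    moreover have "\<forall>i\<in>{1..m}. hitting_time (w i) {int i} \<noteq> \<infinity>"
      using Suc.IH Suc.prems Some by simp
    ultimately show ?thesis by (auto simp: atLeastAtMostSuc_conv)
  qed
qed simp

lemma occupied_subset: "occupied n w i = Some S \<Longrightarrow> S \<subseteq> {1..int n}"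
proof (induction i arbitrary: S)
  case (Suc i)
  then obtain S' t where "occupied n w i = Some S'"
    and "hitting_time (w (Suc i)) ({1..int n} - S') = enat t" and "S = insert (w (Suc i) t) S'"
    by (auto split: option.splits enat.splits)
  then show ?case using Suc.IH[of S'] by (auto simp: hitting_time_eq_enat)
qed simp

text \<open>The characterisation of successful parking by hitting times holds only almost surely, namely
  where all steps are \<open>1\<close> or \<open>- 1\<close>. Conditioning on the event requires its exact measurability, hence this direct
  induction: the occupied set takes finitely many values, and a car parks at one of countably many
  times.\<close>

lemma sets_occupied:
  assumes w: "\<And>j t. j \<in> {1..m} \<Longrightarrow> (\<lambda>x. w x j t) \<in> measurable N (count_space UNIV)"
  shows "i \<le> m \<Longrightarrow> {x \<in> space N. occupied n (w x) i = Some S} \<in> sets N"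
proof (induction i arbitrary: S)
  case 0
  then show ?case by simp
next
  case (Suc i)
  let ?E = "\<lambda>S' t. {x \<in> space N. occupied n (w x) i = Some S'} \<inter>
    ({x \<in> space N. hitting_time (w x (Suc i)) ({1..int n} - S') = enat t} \<inter>
     {x \<in> space N. w x (Suc i) t \<in> {v. insert v S' = S}})"
  have "{x \<in> space N. occupied n (w x) (Suc i) = Some S} = (\<Union>S'\<in>Pow {1..int n}. \<Union>t. ?E S' t)"
  proof (intro set_eqI iffI)
    fix x assume "x \<in> {x \<in> space N. occupied n (w x) (Suc i) = Some S}"
    then obtain S' t where "x \<in> space N" "occupied n (w x) i = Some S'"
      "hitting_time (w x (Suc i)) ({1..int n} - S') = enat t" "S = insert (w x (Suc i) t) S'"
      by (auto split: option.splits enat.splits)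
    moreover from this(2) have "S' \<subseteq> {1..int n}" by (rule occupied_subset)
    ultimately show "x \<in> (\<Union>S'\<in>Pow {1..int n}. \<Union>t. ?E S' t)" by blast
  qed auto
  moreover have "?E S' t \<in> sets N" for S' t
  proof (intro sets.Int)
    show "{x \<in> space N. occupied n (w x) i = Some S'} \<in> sets N" using Suc by simp
    have w': "(\<lambda>x. w x (Suc i) t) \<in> measurable N (count_space UNIV)" for t using w Suc.prems by simp
    have "(\<lambda>x. hitting_time (\<lambda>t. w x (Suc i) t) ({1..int n} - S')) \<in> measurable N (count_space UNIV)"
      by (intro measurable_hitting_time w')
    from measurable_sets[OF this, of "{enat t}"]
    show "{x \<in> space N. hitting_time (w x (Suc i)) ({1..int n} - S') = enat t} \<in> sets N"
      by (simp add: vimage_def Int_def conj_commute)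
    from measurable_sets[OF w', of "{v. insert v S' = S}" t]
    show "{x \<in> space N. w x (Suc i) t \<in> {v. insert v S' = S}} \<in> sets N"
      by (simp add: vimage_def Int_def conj_commute)
  qed
  ultimately show ?case by (simp only:) (intro sets.finite_UN sets.countable_UN', auto)
qed

lemma sum_enat_finite:
  fixes f :: "'i \<Rightarrow> enat"
  assumes "finite I" and "\<forall>i\<in>I. f i \<noteq> \<infinity>"
  shows "(\<Sum>i\<in>I. f i) \<noteq> \<infinity> \<and>
    real_of_ereal (ereal_of_enat (\<Sum>i\<in>I. f i)) = (\<Sum>i\<in>I. real_of_ereal (ereal_of_enat (f i)))"
  using assms
proof (induction I)
  case (insert i I)
  then obtain a b where "f i = enat a" "(\<Sum>i\<in>I. f i) = enat b" by auto
  then show ?case using insert by simp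
qed simp

text \<open>For \<open>p > 1/2\<close> all cars park almost surely, and conditioning on that event changes nothing.\<close>

lemma (in prob_space) uniform_measure_prob_1:
  assumes "prob A = 1" shows "uniform_measure M A = M"
proof -
  have A: "A \<in> events" using assms measure_notin_sets by fastforce
  have "emeasure M A = 1" using assms by (simp add: emeasure_eq_measure)
  then have "uniform_measure M A = density M (indicator A)"
    by (simp add: uniform_measure_def divide_ennreal_def)
  also have "\<dots> = density M (\<lambda>_. 1)"
  proof (rule density_cong)
    show "AE \<omega> in M. indicator A \<omega> = (1 :: ennreal)"
      using AE_prob_1[OF assms] by eventually_elim simp
  qed (use A in auto)
  finally show ?thesis by (simp add: density_1)
qed

context parking_steps
begin

lemma biased_steps_car:
  assumes "i \<in> {1..n}"
  shows "biased_steps M p (\<xi> i)"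
proof unfold_locales
  have "indep_vars (\<lambda>_. count_space UNIV) (\<lambda>k. (case (i, k) of (i, k) \<Rightarrow> \<xi> i k)) UNIV"
    by (rule indep_vars_reindex[OF indep_steps]) (use assms in \<open>auto simp: inj_on_def\<close>)
  then show "indep_vars (\<lambda>_. count_space UNIV) (\<xi> i) UNIV" by simp
qed (rule prob_step_up[OF assms] prob_step_down[OF assms])+

lemma measurable_car_step: "i \<in> {1..n} \<Longrightarrow> \<xi> i k \<in> measurable M (count_space UNIV)"
  using biased_steps.measurable_step[OF biased_steps_car] .

text \<open>The hitting time of car \<open>i\<close> is a function of the \<open>i\<close>-th row of the family of steps, and distinct rows are disjoint.\<close>

lemma indep_hitting_times:
  "indep_vars (\<lambda>_. count_space UNIV) (\<lambda>i \<omega>. hitting_time (walk \<alpha> \<xi> \<omega> i) {int i}) {1..n}"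
proof -
  let ?K = "\<lambda>i. {i} \<times> (UNIV :: nat set)"
  let ?P = "\<lambda>i. PiM (?K i) (\<lambda>_. count_space (UNIV :: int set))"
  have "indep_vars ?P (\<lambda>i \<omega>. restrict (\<lambda>j. (case j of (i, k) \<Rightarrow> \<xi> i k) \<omega>) (?K i)) {1..n}"
    by (rule indep_vars_restrict[OF indep_steps]) (auto simp: disjoint_family_on_def)
  moreover have "(\<lambda>x. hitting_time (\<lambda>t. int (\<alpha> i) + (\<Sum>k<t. x (i, k))) {int i}) \<in> measurable (?P i) (count_space UNIV)" for i
    by (intro measurable_hitting_time measurable_int_sum measurable_component_singleton) simp
  ultimately have "indep_vars (\<lambda>_. count_space UNIV) (\<lambda>i \<omega>. hitting_time (\<lambda>t. int (\<alpha> i) +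
      (\<Sum>k<t. (restrict (\<lambda>j. (case j of (i, k) \<Rightarrow> \<xi> i k) \<omega>) (?K i)) (i, k))) {int i}) {1..n}"
    by (rule indep_vars_compose2)
  then show ?thesis by (simp add: walk_def[abs_def])
qed

context
  fixes \<alpha> d :: "nat \<Rightarrow> nat"
  assumes le: "\<And>i. i \<in> {1..n} \<Longrightarrow> \<alpha> i \<le> i"
    and d: "\<And>i. i \<in> {1..n} \<Longrightarrow> d i = i - \<alpha> i"
begin

lemma hitting_time_eq_passage:
  assumes "i \<in> {1..n}"
  shows "hitting_time (walk \<alpha> \<xi> \<omega> i) {int i} = biased_steps.passage (\<xi> i) (int (\<alpha> i)) (d i) \<omega>"
proof -
  have "int i = int (\<alpha> i) + int (d i)" using le d assms by simp
  then show ?thesis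
    unfolding biased_steps.passage_def[OF biased_steps_car[OF assms]]
    by (simp add: walk_def[abs_def])
qed

lemma AE_all_park_iff:
  "AE \<omega> in M. all_park n \<alpha> \<xi> \<omega> = 1 \<longleftrightarrow> (\<forall>i\<in>{1..n}. hitting_time (walk \<alpha> \<xi> \<omega> i) {int i} \<noteq> \<infinity>)"
proof -
  have "AE \<omega> in M. \<forall>i\<in>{1..n}. \<forall>k. \<xi> i k \<omega> \<in> {-1, 1}"
    using biased_steps.AE_step[OF biased_steps_car] by (intro AE_finite_allI) auto
  then show ?thesis
  proof eventually_elim
    case (elim \<omega>)
    have "occupied n (walk \<alpha> \<xi> \<omega>) n \<noteq> None \<longleftrightarrow>
        (\<forall>i\<in>{1..n}. hitting_time (walk \<alpha> \<xi> \<omega> i) {int i} \<noteq> \<infinity>)"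
    proof (rule occupied_iff_all_hit[OF order_refl])
      show "walk \<alpha> \<xi> \<omega> j 0 \<le> int j" if "j \<in> {1..n}" for j
        using le[OF that] by (simp add: walk_def)
      show "walk \<alpha> \<xi> \<omega> j (Suc t) - walk \<alpha> \<xi> \<omega> j t \<in> {-1, 1}" if "j \<in> {1..n}" for j t
        using elim[rule_format, OF that, of t] by (simp add: walk_def)
    qed
    then show ?case by (simp add: all_park_def)
  qed
qed

lemma sets_all_park: "{\<omega> \<in> space M. all_park n \<alpha> \<xi> \<omega> = 1} \<in> events"
proof -
  have w: "(\<lambda>\<omega>. walk \<alpha> \<xi> \<omega> j t) \<in> measurable M (count_space UNIV)" if "j \<in> {1..n}" for j t
    unfolding walk_def by (rule measurable_int_sum[OF measurable_car_step[OF that]])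
  have "{\<omega> \<in> space M. all_park n \<alpha> \<xi> \<omega> = 1}
      = (\<Union>S\<in>Pow {1..int n}. {\<omega> \<in> space M. occupied n (walk \<alpha> \<xi> \<omega>) n = Some S})"
    using occupied_subset[of n _ n] by (auto simp: all_park_def)
  also have "\<dots> \<in> events" by (intro sets.finite_UN sets_occupied[OF w order_refl]) simp_all
  finally show ?thesis .
qed

text \<open>By independence the probability is the product of the hitting probabilities, whose exponents \<open>d i\<close> add up.
  The case \<open>n = 0\<close> is separate because an empty intersection of events is not the whole space.\<close>

lemma prob_all_park:
  "prob {\<omega> \<in> space M. all_park n \<alpha> \<xi> \<omega> = 1} =
    (if 1/2 \<le> p then 1 else (p / (1 - p)) ^ (\<Sum>i = 1..n. d i))"
proof (cases "n = 0")
  case True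
  then show ?thesis by (simp add: all_park_def prob_space)
next
  case False
  let ?T = "\<lambda>i \<omega>. hitting_time (walk \<alpha> \<xi> \<omega> i) {int i}"
  have T: "?T i -` {e. e \<noteq> \<infinity>} \<inter> space M \<in> events" if "i \<in> {1..n}" for i
    using indep_hitting_times that by (intro measurable_sets[where A = "count_space UNIV"]) (auto simp: indep_vars_def)
  have "prob {\<omega> \<in> space M. all_park n \<alpha> \<xi> \<omega> = 1} = prob (\<Inter>i\<in>{1..n}. ?T i -` {e. e \<noteq> \<infinity>} \<inter> space M)"
  proof (rule finite_measure_eq_AE)
    show "AE \<omega> in M. \<omega> \<in> {\<omega> \<in> space M. all_park n \<alpha> \<xi> \<omega> = 1} \<longleftrightarrow> \<omega> \<in> (\<Inter>i\<in>{1..n}. ?T i -` {e. e \<noteq> \<infinity>} \<inter> space M)"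
      using AE_all_park_iff AE_space
    proof eventually_elim
      case (elim \<omega>)
      then show ?case using False by (simp del: not_infinity_eq)
    qed
    show "(\<Inter>i\<in>{1..n}. ?T i -` {e. e \<noteq> \<infinity>} \<inter> space M) \<in> events"
      using T False by (intro sets.finite_INT) auto
  qed (rule sets_all_park)
  also have "\<dots> = (\<Prod>i\<in>{1..n}. prob (?T i -` {e. e \<noteq> \<infinity>} \<inter> space M))"
    using False by (intro indep_varsD_finite[OF indep_hitting_times]) auto
  also have "\<dots> = (\<Prod>i\<in>{1..n}. if 1/2 \<le> p then 1 else (p / (1 - p)) ^ d i)"
  proof (rule prod.cong)
    fix i assume i: "i \<in> {1..n}"
    have "?T i -` {e. e \<noteq> \<infinity>} \<inter> space M
        = {\<omega> \<in> space M. biased_steps.passage (\<xi> i) (int (\<alpha> i)) (d i) \<omega> \<noteq> \<infinity>}"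
      unfolding hitting_time_eq_passage[OF i] by blast
    then show "prob (?T i -` {e. e \<noteq> \<infinity>} \<inter> space M) = (if 1/2 \<le> p then 1 else (p / (1 - p)) ^ d i)"
      using biased_steps.prob_passage_finite[OF biased_steps_car[OF i]] by simp
  qed simp
  also have "\<dots> = (if 1/2 \<le> p then 1 else (p / (1 - p)) ^ (\<Sum>i = 1..n. d i))"
    by (simp add: power_sum)
  finally show ?thesis .
qed

text \<open>Almost surely all hitting times are finite, and then the real-valued parking time is the sum of their
  real values; means add up, and variances do by independence.\<close>

lemma real_parking_time_moments:
  assumes "1/2 < p"
  shows "AE \<omega> in M. parking_time n \<alpha> \<xi> \<omega> \<noteq> \<infinity>"
    and "integrable M (real_parking_time n \<alpha> \<xi>)"
    and "expectation (real_parking_time n \<alpha> \<xi>) = 1 / (2 * p - 1) * real (\<Sum>i = 1..n. d i)"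
    and "integrable M (\<lambda>\<omega>. (real_parking_time n \<alpha> \<xi> \<omega>)\<^sup>2)"
    and "variance (real_parking_time n \<alpha> \<xi>) = 4 * p * (1 - p) / (2 * p - 1) ^ 3 * real (\<Sum>i = 1..n. d i)"
proof -
  let ?T = "\<lambda>i \<omega>. hitting_time (walk \<alpha> \<xi> \<omega> i) {int i}"
  let ?R = "\<lambda>i \<omega>. real_of_ereal (ereal_of_enat (?T i \<omega>))"
  let ?S = "\<lambda>\<omega>. \<Sum>i = 1..n. ?R i \<omega>"
  let ?\<tau> = "real_parking_time n \<alpha> \<xi>"
  have R: "?R i \<omega> = biased_steps.real_passage (\<xi> i) (int (\<alpha> i)) (d i) \<omega>" if "i \<in> {1..n}" for i \<omega>
    by (simp add: hitting_time_eq_passage[OF that] biased_steps.real_passage_def[OF biased_steps_car[OF that]])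
  have int: "integrable M (?R i)" and E: "expectation (?R i) = real (d i) / (2 * p - 1)"
    and int2: "integrable M (\<lambda>\<omega>. (?R i \<omega>)\<^sup>2)"
    and V: "variance (?R i) = 4 * p * (1 - p) / (2 * p - 1) ^ 3 * real (d i)" if "i \<in> {1..n}" for i
    using biased_steps.real_passage_moments[OF biased_steps_car[OF that] assms, of "int (\<alpha> i)" "d i"]
    by (simp_all only: R[OF that])
  have "indep_vars (\<lambda>_. borel) (\<lambda>i \<omega>. real_of_ereal (ereal_of_enat (?T i \<omega>))) {1..n}"
    by (rule indep_vars_compose2[OF indep_hitting_times]) simp
  from variance_sum[OF _ this int int2]
  have S2: "integrable M (\<lambda>\<omega>. (?S \<omega>)\<^sup>2)" and VS: "variance ?S = (\<Sum>i = 1..n. variance (?R i))" by auto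
  have S: "integrable M ?S" using int by auto
  have ES: "expectation ?S = (\<Sum>i = 1..n. expectation (?R i))" using int by (rule Bochner_Integration.integral_sum)

  have "AE \<omega> in M. ?T i \<omega> \<noteq> \<infinity>" if "i \<in> {1..n}" for i
    unfolding hitting_time_eq_passage[OF that] using assms
    by (intro biased_steps.AE_passage_finite[OF biased_steps_car[OF that]]) simp
  then have fin: "AE \<omega> in M. \<forall>i\<in>{1..n}. ?T i \<omega> \<noteq> \<infinity>"
    by (intro AE_finite_allI) auto
  show "AE \<omega> in M. parking_time n \<alpha> \<xi> \<omega> \<noteq> \<infinity>"
    using fin
  proof eventually_elim
    case (elim \<omega>)
    from sum_enat_finite[OF _ this] show ?case by (simp add: parking_time_def)
  qed
  have eq: "AE \<omega> in M. ?\<tau> \<omega> = ?S \<omega>"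
    using fin
  proof eventually_elim
    case (elim \<omega>)
    from sum_enat_finite[OF _ this] show ?case by (simp add: parking_time_def real_parking_time_def)
  qed
  have "(\<lambda>\<omega>. \<Sum>i\<in>I. ?T i \<omega>) \<in> measurable M (count_space UNIV)" if "I \<subseteq> {1..n}" for I
    using finite_subset[OF that finite_atLeastAtMost] that
  proof (induction I)
    case (insert i I)
    then have [measurable]: "?T i \<in> measurable M (count_space UNIV)"
      "(\<lambda>\<omega>. \<Sum>i\<in>I. ?T i \<omega>) \<in> measurable M (count_space UNIV)"
      using indep_hitting_times by (auto simp: indep_vars_def)
    have "(\<lambda>\<omega>. ?T i \<omega> + (\<Sum>i\<in>I. ?T i \<omega>)) \<in> measurable M (count_space UNIV)" by measurable
    then show ?case using insert.hyps by simp
  qed simp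
  then have "parking_time n \<alpha> \<xi> \<in> measurable M (count_space UNIV)"
    unfolding parking_time_def[abs_def] by simp
  then have \<tau>: "?\<tau> \<in> borel_measurable M"
    unfolding real_parking_time_def[abs_def] by (rule measurable_compose) simp
  have Sm: "?S \<in> borel_measurable M" using S by (rule borel_measurable_integrable)
  have eq2: "AE \<omega> in M. (?\<tau> \<omega>)\<^sup>2 = (?S \<omega>)\<^sup>2" using eq by eventually_elim simp
  show "integrable M ?\<tau>" using S integrable_cong_AE[OF \<tau> Sm eq] by simp
  show "integrable M (\<lambda>\<omega>. (?\<tau> \<omega>)\<^sup>2)"
    using S2 integrable_cong_AE[OF borel_measurable_power[OF \<tau>] borel_measurable_power[OF Sm] eq2] by simp
  have E\<tau>: "expectation ?\<tau> = expectation ?S" by (rule integral_cong_AE[OF \<tau> Sm eq])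
  also have "\<dots> = (\<Sum>i = 1..n. real (d i) / (2 * p - 1))" unfolding ES by (rule sum.cong[OF refl E])
  finally show "expectation ?\<tau> = 1 / (2 * p - 1) * real (\<Sum>i = 1..n. d i)"
    by (simp add: sum_divide_distrib)
  have "variance ?\<tau> = variance ?S"
    unfolding E\<tau>
  proof (rule integral_cong_AE)
    show "AE \<omega> in M. (?\<tau> \<omega> - expectation ?S)\<^sup>2 = (?S \<omega> - expectation ?S)\<^sup>2"
      using eq by eventually_elim simp
  qed (use \<tau> Sm in simp_all)
  also have "\<dots> = (\<Sum>i = 1..n. 4 * p * (1 - p) / (2 * p - 1) ^ 3 * real (d i))"
    unfolding VS by (rule sum.cong[OF refl V])
  finally show "variance ?\<tau> = 4 * p * (1 - p) / (2 * p - 1) ^ 3 * real (\<Sum>i = 1..n. d i)"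
    by (simp add: sum_distrib_left)
qed

end

end

theorem corollary3p3:
  fixes M :: "'a measure" and \<xi> :: "nat \<Rightarrow> nat \<Rightarrow> 'a \<Rightarrow> int"
    and n :: nat and p q :: real and \<alpha> d :: "nat \<Rightarrow> nat"
  assumes "0 \<le> p" and "p \<le> 1" and "q = 1 - p"
    and "parking_steps M n p \<xi>"
    and "\<alpha> \<in> {1..n} \<rightarrow> {1..n}" and "\<forall>i\<in>{1..n}. \<alpha> i \<le> i"
    and "\<forall>i\<in>{1..n}. d i = i - \<alpha> i"
  shows "measure M {\<omega> \<in> space M. all_park n \<alpha> \<xi> \<omega> = 1} =
      (if 1/2 \<le> p then 1 else (p / q) ^ (\<Sum>i = 1..n. d i)) \<and>
    (1/2 < p \<longrightarrow>
      (let C = uniform_measure M {\<omega> \<in> space M. all_park n \<alpha> \<xi> \<omega> = 1};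
           \<tau> = real_parking_time n \<alpha> \<xi>
       in (AE \<omega> in C. parking_time n \<alpha> \<xi> \<omega> \<noteq> \<infinity>) \<and>
          integrable C \<tau> \<and>
          prob_space.expectation C \<tau> = 1 / (p - q) * real (\<Sum>i = 1..n. d i) \<and>
          integrable C (\<lambda>\<omega>. (\<tau> \<omega>)\<^sup>2) \<and>
          prob_space.variance C \<tau> = 4 * p * q / (p - q) ^ 3 * real (\<Sum>i = 1..n. d i)))"
proof -
  interpret parking_steps M n p \<xi> by fact
  have le: "\<And>i. i \<in> {1..n} \<Longrightarrow> \<alpha> i \<le> i" and d: "\<And>i. i \<in> {1..n} \<Longrightarrow> d i = i - \<alpha> i"
    using assms(6,7) by auto
  note prob = prob_all_park[OF le d]
  have C: "uniform_measure M {\<omega> \<in> space M. all_park n \<alpha> \<xi> \<omega> = 1} = M" if "1/2 < p"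
    by (rule uniform_measure_prob_1) (use prob that in simp)
  have drift: "p - (1 - p) = 2 * p - 1" by simp
  show ?thesis
  proof (intro conjI impI)
    show "prob {\<omega> \<in> space M. all_park n \<alpha> \<xi> \<omega> = 1} =
        (if 1/2 \<le> p then 1 else (p / q) ^ (\<Sum>i = 1..n. d i))"
      unfolding \<open>q = 1 - p\<close> by (rule prob)
  next
    assume "1/2 < p"
    from real_parking_time_moments[OF le d this]
    show "let C = uniform_measure M {\<omega> \<in> space M. all_park n \<alpha> \<xi> \<omega> = 1};
           \<tau> = real_parking_time n \<alpha> \<xi>
       in (AE \<omega> in C. parking_time n \<alpha> \<xi> \<omega> \<noteq> \<infinity>) \<and>
          integrable C \<tau> \<and>
          prob_space.expectation C \<tau> = 1 / (p - q) * real (\<Sum>i = 1..n. d i) \<and>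
          integrable C (\<lambda>\<omega>. (\<tau> \<omega>)\<^sup>2) \<and>
          prob_space.variance C \<tau> = 4 * p * q / (p - q) ^ 3 * real (\<Sum>i = 1..n. d i)"
      unfolding Let_def C[OF \<open>1/2 < p\<close>] \<open>q = 1 - p\<close> drift by (intro conjI)
  qed
qed

end
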